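(* A (possibly infinite) simple graph $G$ is chordal if and only if $G$ is wheel-free and its binary cycle space is generated by its triangles, i.e., the edge set of each cycle of $G$ is the symmetric difference of the edge sets of finitely many triangles of $G$.
   Context: A graph is chordal if every cycle of length at least $4$ has a chord. A wheel $W_n$ ($n\ge4$) is a cycle of length $n$ together with a vertex adjacent to all its vertices; a graph is wheel-free if it has no induced subgraph isomorphic to some $W_n$ with $n\ge 4$. A triangle is a cycle of length $3$. The binary cycle space of $G$ is the $\mathbb{Z}_2$-vector space (under symmetric difference) of edge sets generated by edge sets of cycles, where an element is generated by a set $\mathcal{C}$ if it is the symmetric difference of finitely many elements of $\mathcal{C}$. *)

theory Defs
  imports Main
begin

definition simple_graph :: "'a set \<Rightarrow> 'a set set \<Rightarrow> bool" where
  "simple_graph V E \<longleftrightarrow> (\<forall>e\<in>E. \<exists>u\<in>V. \<exists>v\<in>V. u \<noteq> v \<and> e = {u, v})"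

text \<open>A cycle is represented by the list of its vertices in cyclic order; lists that differ by a
  rotation or a reversal represent the same cycle.\<close>

definition cycle_edges :: "'a list \<Rightarrow> 'a set set" where
  "cycle_edges vs = {{vs ! i, vs ! (Suc i mod length vs)} | i. i < length vs}"

definition is_cycle :: "'a set \<Rightarrow> 'a set set \<Rightarrow> 'a list \<Rightarrow> bool" where
  "is_cycle V E vs \<longleftrightarrow>
     3 \<le> length vs \<and> distinct vs \<and> set vs \<subseteq> V \<and> cycle_edges vs \<subseteq> E"

definition is_triangle :: "'a set \<Rightarrow> 'a set set \<Rightarrow> 'a list \<Rightarrow> bool" where
  "is_triangle V E vs \<longleftrightarrow> is_cycle V E vs \<and> length vs = 3"

definition is_chord :: "'a set set \<Rightarrow> 'a list \<Rightarrow> 'a set \<Rightarrow> bool" where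
  "is_chord E vs e \<longleftrightarrow> e \<in> E \<and> e \<subseteq> set vs \<and> e \<notin> cycle_edges vs"

definition chordal :: "'a set \<Rightarrow> 'a set set \<Rightarrow> bool" where
  "chordal V E \<longleftrightarrow> (\<forall>vs. is_cycle V E vs \<and> 4 \<le> length vs \<longrightarrow> (\<exists>e. is_chord E vs e))"

definition induced_edges :: "'a set set \<Rightarrow> 'a set \<Rightarrow> 'a set set" where
  "induced_edges E S = {e \<in> E. e \<subseteq> S}"

definition graph_isomorphic ::
    "'a set \<Rightarrow> 'a set set \<Rightarrow> 'b set \<Rightarrow> 'b set set \<Rightarrow> bool" where
  "graph_isomorphic V E V' E' \<longleftrightarrow>
     (\<exists>f. bij_betw f V V' \<and> (\<forall>u\<in>V. \<forall>v\<in>V. {u, v} \<in> E \<longleftrightarrow> {f u, f v} \<in> E'))"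

text \<open>The wheel with rim \<open>0, \<dots>, n - 1\<close> and hub \<open>n\<close>.\<close>

definition wheel_verts :: "nat \<Rightarrow> nat set" where
  "wheel_verts n = {..n}"

definition wheel_edges :: "nat \<Rightarrow> nat set set" where
  "wheel_edges n = cycle_edges [0..<n] \<union> {{i, n} | i. i < n}"

definition wheel_free :: "'a set \<Rightarrow> 'a set set \<Rightarrow> bool" where
  "wheel_free V E \<longleftrightarrow>
     \<not> (\<exists>n\<ge>4. \<exists>S\<subseteq>V. graph_isomorphic S (induced_edges E S) (wheel_verts n) (wheel_edges n))"

text \<open>The set of all symmetric differences of finitely many members of \<open>\<C>\<close>.\<close>

definition sym_diff_span :: "'e set set \<Rightarrow> 'e set set" where
  "sym_diff_span \<C> = {foldr sym_diff Cs {} | Cs. set Cs \<subseteq> \<C>}"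

definition cycle_edge_sets :: "'a set \<Rightarrow> 'a set set \<Rightarrow> 'a set set set" where
  "cycle_edge_sets V E = {cycle_edges vs | vs. is_cycle V E vs}"

definition triangle_edge_sets :: "'a set \<Rightarrow> 'a set set \<Rightarrow> 'a set set set" where
  "triangle_edge_sets V E = {cycle_edges vs | vs. is_triangle V E vs}"

definition binary_cycle_space :: "'a set \<Rightarrow> 'a set set \<Rightarrow> 'a set set set" where
  "binary_cycle_space V E = sym_diff_span (cycle_edge_sets V E)"

lemma foldr_sym_diff_append:
  "foldr sym_diff (As @ Bs) {} = sym_diff (foldr sym_diff As {}) (foldr sym_diff Bs {})"
  by (induction As) auto

lemma sym_diff_span_superset: "\<C> \<subseteq> sym_diff_span \<C>"
proof
  fix C assume "C \<in> \<C>"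
  then have "set [C] \<subseteq> \<C>" "C = foldr sym_diff [C] {}" by auto
  then show "C \<in> sym_diff_span \<C>" unfolding sym_diff_span_def by blast
qed

lemma sym_diff_span_closed:
  assumes "A \<in> sym_diff_span \<C>" "B \<in> sym_diff_span \<C>"
  shows "sym_diff A B \<in> sym_diff_span \<C>"
proof -
  obtain As Bs where "set As \<subseteq> \<C>" "A = foldr sym_diff As {}"
    "set Bs \<subseteq> \<C>" "B = foldr sym_diff Bs {}"
    using assms unfolding sym_diff_span_def by blast
  then have "set (As @ Bs) \<subseteq> \<C>" "sym_diff A B = foldr sym_diff (As @ Bs) {}"
    by (simp_all only: foldr_sym_diff_append) auto
  then show ?thesis unfolding sym_diff_span_def by blast
qed

lemma sym_diff_span_mono: "\<C> \<subseteq> \<D> \<Longrightarrow> sym_diff_span \<C> \<subseteq> sym_diff_span \<D>"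
  unfolding sym_diff_span_def by blast

lemma sym_diff_span_least:
  assumes "\<C> \<subseteq> sym_diff_span \<D>"
  shows "sym_diff_span \<C> \<subseteq> sym_diff_span \<D>"
proof
  fix X assume "X \<in> sym_diff_span \<C>"
  then obtain Cs where Cs: "set Cs \<subseteq> \<C>" and X: "X = foldr sym_diff Cs {}"
    unfolding sym_diff_span_def by blast
  have "foldr sym_diff Cs {} \<in> sym_diff_span \<D>"
    using Cs
  proof (induction Cs)
    case Nil
    have "set [] \<subseteq> \<D>" by simp
    then show ?case unfolding sym_diff_span_def by blast
  next
    case (Cons C Cs)
    then have "C \<in> sym_diff_span \<D>" "foldr sym_diff Cs {} \<in> sym_diff_span \<D>"
      using assms by auto
    from sym_diff_span_closed[OF this] show ?case by simp
  qed
  then show "X \<in> sym_diff_span \<D>" using X by simp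
qed

lemma binary_cycle_space_generated_by_triangles_iff:
  "binary_cycle_space V E = sym_diff_span (triangle_edge_sets V E) \<longleftrightarrow>
   (\<forall>vs. is_cycle V E vs \<longrightarrow>
      (\<exists>Ts. set Ts \<subseteq> triangle_edge_sets V E \<and> cycle_edges vs = foldr sym_diff Ts {}))"
    (is "?L \<longleftrightarrow> ?R")
proof -
  have sub: "triangle_edge_sets V E \<subseteq> cycle_edge_sets V E"
    unfolding triangle_edge_sets_def cycle_edge_sets_def is_triangle_def by blast
  have R: "?R \<longleftrightarrow> cycle_edge_sets V E \<subseteq> sym_diff_span (triangle_edge_sets V E)"
    unfolding cycle_edge_sets_def sym_diff_span_def by blast
  show ?thesis
    unfolding R binary_cycle_space_def
    using sym_diff_span_superset[of "cycle_edge_sets V E"] sym_diff_span_mono[OF sub]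
      sym_diff_span_least[of "cycle_edge_sets V E" "triangle_edge_sets V E"]
    by blast
qed

end

theory Submission
  imports Defs
begin

text \<open>
  A cycle with a chord is the sum of two shorter cycles, so in a chordal graph the triangles
  generate. Conversely, wheel-freeness says that every neighbourhood \<open>N(v)\<close> induces a chordal
  graph. Suppose a chordless cycle \<open>C\<close> of length at least 4 is a finite sum of triangles, and let
  \<open>v\<close> be a vertex of these triangles that is not on \<open>C\<close>. The sum of the triangles through \<open>v\<close> has
  no edge at \<open>v\<close>, since \<open>C\<close> has none; hence it is an even edge set inside \<open>N(v)\<close>, and therefore a
  sum of triangles inside \<open>N(v)\<close>. Thus \<open>v\<close> can be avoided without introducing new vertices.
  Eliminating all vertices off \<open>C\<close> in this way writes \<open>C\<close> as a sum of triangles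
  with all vertices on \<open>C\<close>, but there are none.
\<close>

section \<open>Edges of walks\<close>

fun walk_edges :: "'a list \<Rightarrow> 'a set set" where
  "walk_edges (x # y # zs) = insert {x, y} (walk_edges (y # zs))"
| "walk_edges _ = {}"

text \<open>The edges of a walk counted modulo 2, so that an edge traversed twice cancels. Unlike
  \<open>walk_edges\<close> it turns concatenation into symmetric difference even when the pieces
  share edges.\<close>

fun walk_sum :: "'a list \<Rightarrow> 'a set set" where
  "walk_sum (x # y # zs) = sym_diff {{x, y}} (walk_sum (y # zs))"
| "walk_sum _ = {}"

lemma walk_edges_append:
  "walk_edges (xs @ x # ys) = walk_edges (xs @ [x]) \<union> walk_edges (x # ys)"
  by (induction xs rule: walk_edges.induct) auto

lemma walk_sum_append:
  "walk_sum (xs @ x # ys) = sym_diff (walk_sum (xs @ [x])) (walk_sum (x # ys))"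
proof (induction xs rule: walk_sum.induct)
  case (1 a b zs)
  then show ?case by (simp del: Un_Diff_cancel) blast
qed auto

lemma walk_edges_conv_nth:
  "walk_edges ws = {{ws ! i, ws ! Suc i} | i. Suc i < length ws}"
proof (induction ws rule: walk_edges.induct)
  case (1 x y zs)
  have "{{(x # y # zs) ! i, (x # y # zs) ! Suc i} | i. Suc i < length (x # y # zs)}
      = insert {x, y} {{(y # zs) ! i, (y # zs) ! Suc i} | i. Suc i < length (y # zs)}"
    (is "?A = insert _ ?B")
  proof (intro equalityI subsetI)
    fix e assume "e \<in> ?A"
    then obtain i where "e = {(x # y # zs) ! i, (x # y # zs) ! Suc i}" "Suc i < length (x # y # zs)"
      by blast
    then show "e \<in> insert {x, y} ?B" by (cases i) auto
  next
    fix e assume "e \<in> insert {x, y} ?B"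
    then consider "e = {x, y}"
      | i where "e = {(y # zs) ! i, (y # zs) ! Suc i}" "Suc i < length (y # zs)"
      by blast
    then show "e \<in> ?A"
    proof cases
      case 1
      then show ?thesis by force
    next
      case (2 i)
      then have "e = {(x # y # zs) ! Suc i, (x # y # zs) ! Suc (Suc i)}"
        "Suc (Suc i) < length (x # y # zs)" by auto
      then show ?thesis by blast
    qed
  qed
  with 1 show ?case by simp
qed auto

lemma walk_edges_subset: "e \<in> walk_edges ws \<Longrightarrow> e \<subseteq> set ws"
  by (induction ws rule: walk_edges.induct) auto

lemma finite_walk_sum: "finite (walk_sum ws)"
  by (induction ws rule: walk_sum.induct) auto

text \<open>The first vertex does not recur, so the first edge is not among the later ones and
  nothing cancels.\<close>

lemma walk_sum_eq_walk_edges: "distinct ws \<Longrightarrow> walk_sum ws = walk_edges ws"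
proof (induction ws rule: walk_sum.induct)
  case (1 x y zs)
  have "{x, y} \<notin> walk_edges (y # zs)"
    using "1.prems" walk_edges_subset[of "{x, y}" "y # zs"] by auto
  with 1 show ?case by auto
qed auto

text \<open>Repeating the first vertex at the end turns the wrap-around index
  \<open>Suc i mod length vs\<close> into an ordinary successor.\<close>

lemma cycle_edges_eq_walk_edges:
  assumes "vs \<noteq> []"
  shows "cycle_edges vs = walk_edges (vs @ [hd vs])"
proof -
  have "(vs @ [hd vs]) ! i = vs ! i \<and> (vs @ [hd vs]) ! Suc i = vs ! (Suc i mod length vs)"
    if "i < length vs" for i
    using that assms by (cases "Suc i = length vs") (auto simp: nth_append hd_conv_nth)
  moreover have "Suc i < length (vs @ [hd vs]) \<longleftrightarrow> i < length vs" for i by simp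
  ultimately show ?thesis
    unfolding cycle_edges_def walk_edges_conv_nth by (intro Collect_cong) metis
qed

text \<open>Only the closing edge could cancel. It contains \<open>x\<close>, which lies on no path
  edge but \<open>{x, y}\<close>, and \<open>z\<close> differs from \<open>y\<close> because there
  are at least three vertices; on two vertices the closed walk would sum to the empty set.\<close>

lemma cycle_edges_eq_walk_sum:
  assumes "distinct vs" "3 \<le> length vs"
  shows "cycle_edges vs = walk_sum (vs @ [hd vs])"
proof -
  obtain x y ys where "vs = x # y # ys" "ys \<noteq> []"
    using assms(2) by (cases vs; cases "tl vs"; force)
  then obtain zs z where vs: "vs = x # y # zs @ [z]"
    by (metis rev_exhaust)
  have "{z, x} \<notin> walk_edges (x # y # zs @ [z])"
    using assms(1) walk_edges_subset[of "{z, x}" "y # zs @ [z]"]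
    by (auto simp: vs doubleton_eq_iff)
  moreover have "cycle_edges vs = insert {z, x} (walk_edges (x # y # zs @ [z]))"
    using walk_edges_append[of "x # y # zs" z "[x]"] cycle_edges_eq_walk_edges[of vs] vs by simp
  moreover have "walk_sum (vs @ [hd vs]) = sym_diff (walk_edges (x # y # zs @ [z])) {{z, x}}"
    using walk_sum_append[of "x # y # zs" z "[x]"] walk_sum_eq_walk_edges[OF assms(1)] vs
    by simp
  ultimately show ?thesis by auto
qed

lemma cycle_edges_subset: "e \<in> cycle_edges vs \<Longrightarrow> e \<subseteq> set vs"
  unfolding cycle_edges_def by (auto intro!: nth_mem mod_less_divisor)

lemma cycle_edges_nonempty: "vs \<noteq> [] \<Longrightarrow> cycle_edges vs \<noteq> {}"
  by (auto simp: cycle_edges_def)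

lemma finite_cycle_edges: "finite (cycle_edges vs)"
  by (simp add: cycle_edges_def)

text \<open>Distinctness makes positions unique, so adjacency on a cycle becomes arithmetic of
  indices. This serves to compare rims with wheels and to exclude triangles.\<close>

lemma doubleton_in_cycle_edges_iff:
  assumes "distinct vs" "i < length vs" "j < length vs"
  shows "{vs ! i, vs ! j} \<in> cycle_edges vs \<longleftrightarrow>
    j = Suc i mod length vs \<or> i = Suc j mod length vs"
proof -
  have "Suc k mod length vs < length vs" for k
    using assms(2) by (intro mod_less_divisor) auto
  then show ?thesis
    using assms unfolding cycle_edges_def
    by (auto simp: doubleton_eq_iff nth_eq_iff_index_eq)
qed

section \<open>Even edge sets\<close>

text \<open>An infinite set of incident edges has \<open>card\<close> 0 and would count as even;
  hence the finiteness assumptions below.\<close>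

definition odd_degree :: "'a \<Rightarrow> 'a set set \<Rightarrow> bool" where
  "odd_degree x L \<longleftrightarrow> odd (card {e \<in> L. x \<in> e})"

lemma odd_card_sym_diff:
  assumes "finite A" "finite B"
  shows "odd (card (sym_diff A B)) \<longleftrightarrow> odd (card A) \<noteq> odd (card B)"
proof -
  have "card (sym_diff A B) = card (A - B) + card (B - A)"
    using assms by (intro card_Un_disjoint) auto
  moreover have "card A = card (A - B) + card (A \<inter> B)"
    using assms by (metis card_Diff_subset_Int card_mono finite_Int inf_le1 le_add_diff_inverse2)
  moreover have "card B = card (B - A) + card (A \<inter> B)"
    using assms
    by (metis card_Diff_subset_Int card_mono finite_Int inf_commute inf_le1 le_add_diff_inverse2)
  ultimately show ?thesis by auto
qed

lemma odd_degree_sym_diff: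
  assumes "finite A" "finite B"
  shows "odd_degree x (sym_diff A B) \<longleftrightarrow> odd_degree x A \<noteq> odd_degree x B"
proof -
  have "{e \<in> sym_diff A B. x \<in> e} = sym_diff {e \<in> A. x \<in> e} {e \<in> B. x \<in> e}" by auto
  then show ?thesis
    unfolding odd_degree_def using odd_card_sym_diff[of "{e \<in> A. x \<in> e}" "{e \<in> B. x \<in> e}"] assms
    by simp
qed

lemma odd_degree_edge: "a \<noteq> b \<Longrightarrow> odd_degree x {{a, b}} \<longleftrightarrow> (x = a) \<noteq> (x = b)"
proof -
  assume "a \<noteq> b"
  moreover have "{e \<in> {{a, b}}. x \<in> e} = (if x = a \<or> x = b then {{a, b}} else {})" by auto
  ultimately show ?thesis by (auto simp: odd_degree_def)
qed

text \<open>Prepending an edge flips the parity at its two ends, which moves the odd end from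
  \<open>b\<close> to \<open>a\<close>. The assumption \<open>distinct_adj\<close> excludes loops.
  For a closed walk the two conditions coincide and no vertex is odd.\<close>

lemma odd_degree_walk_sum:
  "distinct_adj ws \<Longrightarrow> ws \<noteq> [] \<Longrightarrow> odd_degree x (walk_sum ws) \<longleftrightarrow> (x = hd ws) \<noteq> (x = last ws)"
proof (induction ws rule: walk_sum.induct)
  case (1 a b zs)
  then show ?case
    using odd_degree_sym_diff[of "{{a, b}}" "walk_sum (b # zs)" x] odd_degree_edge[of a b x]
      finite_walk_sum[of "b # zs"]
    by auto
qed (auto simp: odd_degree_def)

lemma even_degree_cycle_edges:
  assumes "distinct vs" "3 \<le> length vs"
  shows "\<not> odd_degree x (cycle_edges vs)"
proof -
  obtain a b ys where "vs = a # b # ys" "ys \<noteq> []"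
    using assms(2) by (cases vs; cases "tl vs"; force)
  moreover have "distinct_adj vs"
    using assms(1) by (auto simp: distinct_adj_conv_nth nth_eq_iff_index_eq)
  moreover have "last vs \<noteq> hd vs" using calculation(1,2) assms(1) last_in_set[of ys] by auto
  ultimately have "distinct_adj (vs @ [hd vs])" by (simp only: distinct_adj_append_iff) simp
  then show ?thesis
    using odd_degree_walk_sum[of "vs @ [hd vs]" x] cycle_edges_eq_walk_sum[OF assms] assms(2)
    by (cases vs) auto
qed

text \<open>Take a longest path in \<open>L\<close>. By parity its first vertex \<open>x\<close> has
  a second edge in \<open>L\<close>; by maximality the other end of that edge is on the path, which
  closes a cycle.\<close>

lemma even_edge_set_contains_cycle:
  assumes "simple_graph V E" "L \<subseteq> E" "finite L" "L \<noteq> {}" "\<And>x. \<not> odd_degree x L"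
  shows "\<exists>vs. is_cycle V E vs \<and> cycle_edges vs \<subseteq> L"
proof -
  define P where "P vs \<longleftrightarrow> distinct vs \<and> set vs \<subseteq> \<Union>L \<and> walk_edges vs \<subseteq> L \<and> 2 \<le> length vs" for vs
  have ends: "\<exists>u v. u \<in> V \<and> v \<in> V \<and> u \<noteq> v \<and> e = {u, v}" if "e \<in> L" for e
    using bspec[OF assms(1)[unfolded simple_graph_def], of e] assms(2) that by blast
  have "finite (\<Union>L)" using assms(3) ends by fastforce
  then have bound: "length vs \<le> card (\<Union>L)" if "P vs" for vs
    using that unfolding P_def by (metis card_mono distinct_card)
  obtain e u v where "e \<in> L" "u \<noteq> v" "e = {u, v}" using assms(4) ends by blast
  then have "P [u, v]" unfolding P_def by auto
  then obtain vs where vs: "P vs" and longest: "\<And>ws. P ws \<Longrightarrow> length ws \<le> length vs"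
    using ex_has_greatest_nat[of P "[u, v]" length "Suc (card (\<Union>L))"] bound le_imp_less_Suc
    by metis
  then obtain x y zs where xyz: "vs = x # y # zs"
    unfolding P_def by (cases vs; cases "tl vs"; auto)
  have "{e \<in> L. x \<in> e} \<noteq> {{x, y}}"
  proof
    assume "{e \<in> L. x \<in> e} = {{x, y}}"
    then have "odd_degree x L" by (simp add: odd_degree_def)
    with assms(5) show False by blast
  qed
  moreover have xy: "{x, y} \<in> L" using vs xyz unfolding P_def by auto
  ultimately obtain f where f: "f \<in> L" "x \<in> f" "f \<noteq> {x, y}" by blast
  then obtain z where z: "f = {x, z}" "z \<noteq> x" "z \<noteq> y" using ends[of f] by fastforce
  have "z \<in> set vs"
  proof (rule ccontr)
    assume "z \<notin> set vs"
    then have "P (z # vs)"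
      using vs f z unfolding P_def by (auto simp: xyz insert_commute)
    then show False using longest by fastforce
  qed
  then obtain as bs where zs: "zs = as @ z # bs"
    using z xyz by (auto dest: split_list)
  \<comment> \<open>The initial segment of the path up to \<open>z\<close>, closed by the edge
    \<open>f\<close>. It has at least three vertices because \<open>z\<close> is not
    \<open>y\<close>.\<close>
  define ws where "ws = x # y # as @ [z]"
  have "walk_edges vs = walk_edges ws \<union> walk_edges (z # bs)"
    using walk_edges_append[of "x # y # as" z bs] by (simp add: ws_def xyz zs)
  then have "walk_edges ws \<subseteq> L" using vs unfolding P_def by auto
  moreover have "cycle_edges ws = walk_edges ws \<union> {{z, x}}"
    using walk_edges_append[of "x # y # as" z "[x]"] cycle_edges_eq_walk_edges[of ws]
    by (simp add: ws_def)
  ultimately have "cycle_edges ws \<subseteq> L" using f z by (auto simp: insert_commute)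
  moreover have "\<Union>L \<subseteq> V" using ends by blast
  then have "set ws \<subseteq> V" "distinct ws" "3 \<le> length ws"
    using vs unfolding P_def by (auto simp: ws_def xyz zs)
  ultimately show ?thesis using assms(2) unfolding is_cycle_def by blast
qed

section \<open>Finite even edge sets as sums of cycles\<close>

lemma empty_in_sym_diff_span: "{} \<in> sym_diff_span \<C>"
  unfolding sym_diff_span_def by (auto intro!: exI[of _ "[]"])

lemma cycle_edges_in_binary_cycle_space:
  "is_cycle V E vs \<Longrightarrow> cycle_edges vs \<in> binary_cycle_space V E"
  unfolding binary_cycle_space_def
  by (rule subsetD[OF sym_diff_span_superset]) (auto simp: cycle_edge_sets_def)

lemma even_edge_set_in_binary_cycle_space:
  assumes "simple_graph V E" "L \<subseteq> E" "finite L" "\<And>x. \<not> odd_degree x L"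
  shows "L \<in> binary_cycle_space V E"
  using assms(2-)
proof (induction "card L" arbitrary: L rule: less_induct)
  case less
  show ?case
  proof (cases "L = {}")
    case True
    then show ?thesis by (simp add: binary_cycle_space_def empty_in_sym_diff_span)
  next
    case False
    then obtain vs where vs: "is_cycle V E vs" "cycle_edges vs \<subseteq> L"
      using even_edge_set_contains_cycle[OF assms(1) less.prems(1,2)] less.prems(3) by blast
    \<comment> \<open>As a symmetric difference \<open>M\<close> inherits even degrees; as a set
      difference it is smaller than \<open>L\<close>.\<close>
    define M where "M = sym_diff L (cycle_edges vs)"
    have M: "M = L - cycle_edges vs" using vs(2) by (auto simp: M_def)
    have "cycle_edges vs \<noteq> {}"
      using vs(1) cycle_edges_nonempty[of vs] by (force simp: is_cycle_def)
    then have "card M < card L"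
      using vs(2) less.prems(2) unfolding M by (intro psubset_card_mono) auto
    moreover have "\<not> odd_degree x M" for x
      using odd_degree_sym_diff[OF less.prems(2) finite_cycle_edges, of x vs]
        even_degree_cycle_edges[of vs x] less.prems(3)[of x] vs(1)
      unfolding M_def is_cycle_def by blast
    ultimately have "M \<in> binary_cycle_space V E"
      using less.hyps[of M] less.prems by (auto simp: M)
    moreover have "cycle_edges vs \<in> binary_cycle_space V E"
      using vs(1) by (rule cycle_edges_in_binary_cycle_space)
    ultimately have "sym_diff M (cycle_edges vs) \<in> binary_cycle_space V E"
      unfolding binary_cycle_space_def by (rule sym_diff_span_closed)
    moreover have "sym_diff M (cycle_edges vs) = L" using vs(2) by (auto simp: M)
    ultimately show ?thesis by simp
  qed
qed

section \<open>Chordal graphs are generated by triangles\<close>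

text \<open>Naming the two members in their order of occurrence removes a symmetric case when a
  chord cuts a cycle.\<close>

lemma obtain_split_of_two_members:
  assumes "u \<in> set vs" "v \<in> set vs" "u \<noteq> v"
  obtains as x bs y cs where "vs = as @ x # bs @ y # cs" "{u, v} = {x, y}"
proof -
  obtain ps qs where vs: "vs = ps @ u # qs" using assms(1) split_list by fast
  consider "v \<in> set ps" | "v \<in> set qs" using assms(2,3) vs by auto
  then show thesis
  proof cases
    case 1
    then obtain as bs where "ps = as @ v # bs" using split_list by fast
    then show thesis using that[of as v bs u qs] vs by auto
  next
    case 2
    then obtain bs cs where "qs = bs @ v # cs" using split_list by fast
    then show thesis using that[of ps u bs v cs] vs by auto
  qed
qed

text \<open>The chord closes each of the two arcs between its ends to a cycle. It lies on both
  cycles and cancels in their sum.\<close>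

lemma cycle_with_chord_splits:
  assumes "simple_graph V E" "is_cycle V E vs" "is_chord E vs e"
  obtains us ws where "is_cycle V E us" "is_cycle V E ws"
    "length us < length vs" "length ws < length vs"
    "cycle_edges vs = sym_diff (cycle_edges us) (cycle_edges ws)"
proof -
  have e: "e \<in> E" "e \<subseteq> set vs" "e \<notin> cycle_edges vs" using assms(3) by (auto simp: is_chord_def)
  then obtain u v where "u \<noteq> v" "e = {u, v}" using assms(1) unfolding simple_graph_def by blast
  then obtain as x bs y cs where vs: "vs = as @ x # bs @ y # cs" and exy: "e = {x, y}"
    using e(2) by (metis insert_subset obtain_split_of_two_members)
  \<comment> \<open>The wrap-around edge ends in \<open>h\<close>, which is \<open>x\<close> when
    \<open>as\<close> is empty; the name treats both cases alike.\<close>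
  define h where "h = hd vs"
  have h: "h = hd (as @ [x])" by (cases as) (auto simp: h_def vs)
  define us where "us = x # bs @ [y]"
  define ws where "ws = as @ x # y # cs"
  have cyc: "distinct vs" "set vs \<subseteq> V" "cycle_edges vs \<subseteq> E" "3 \<le> length vs"
    using assms(2) by (auto simp: is_cycle_def)
  have hws: "hd ws = h" unfolding ws_def h by (cases as) auto
  have ne: "vs \<noteq> []" "us \<noteq> []" "ws \<noteq> []" by (auto simp: vs us_def ws_def)
  have edges_vs: "cycle_edges vs =
      walk_edges (as @ [x]) \<union> walk_edges (x # bs @ [y]) \<union> walk_edges (y # cs @ [h])"
    using cycle_edges_eq_walk_edges[OF ne(1)] walk_edges_append[of as x "bs @ y # cs @ [h]"]
      walk_edges_append[of "x # bs" y "cs @ [h]"]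
    by (simp add: vs flip: h_def) (auto simp: vs h_def)
  have edges_us: "cycle_edges us = walk_edges (x # bs @ [y]) \<union> {e}"
    using cycle_edges_eq_walk_edges[OF ne(2)] walk_edges_append[of "x # bs" y "[x]"]
    by (simp add: us_def exy insert_commute)
  have edges_ws: "cycle_edges ws = walk_edges (as @ [x]) \<union> {e} \<union> walk_edges (y # cs @ [h])"
    using cycle_edges_eq_walk_edges[OF ne(3)] walk_edges_append[of as x "y # cs @ [h]"]
    unfolding hws by (simp add: ws_def exy)
  \<comment> \<open>If \<open>bs\<close> were empty, or \<open>as\<close> and \<open>cs\<close> both
    were, the chord would be an edge of the cycle. Hence both new cycles have at least three
    vertices and are shorter than \<open>vs\<close>.\<close>
  have "e \<notin> walk_edges (x # bs @ [y])" "e \<notin> walk_edges (y # cs @ [h])"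
    using edges_vs e(3) by blast+
  then have "bs \<noteq> []" "as \<noteq> [] \<or> cs \<noteq> []"
    unfolding exy h by (auto simp: insert_commute)
  then have lengths: "3 \<le> length us" "3 \<le> length ws"
      "length us < length vs" "length ws < length vs"
    by (auto simp: us_def ws_def vs Suc_le_eq)
  have dist: "distinct us" "distinct ws" using cyc(1) by (auto simp: us_def ws_def vs)
  have cycles: "is_cycle V E us" "is_cycle V E ws"
    using lengths dist cyc e(1) edges_vs edges_us edges_ws unfolding is_cycle_def
    by (auto simp: us_def ws_def vs)
  \<comment> \<open>Here \<open>B\<close> is the inner arc, \<open>A\<close> and \<open>C\<close>
    are the two pieces of the outer one, and \<open>D\<close> is the chord, inserted twice.\<close>
  have regroup: "sym_diff A (sym_diff B C) = sym_diff (sym_diff B D) (sym_diff A (sym_diff D C))"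
    for A B C D :: "'a set set" by blast
  have "cycle_edges vs = sym_diff (walk_sum (as @ [x]))
      (sym_diff (walk_sum (x # bs @ [y])) (walk_sum (y # cs @ [h])))"
    using cycle_edges_eq_walk_sum[OF cyc(1,4)] walk_sum_append[of as x "bs @ y # cs @ [h]"]
      walk_sum_append[of "x # bs" y "cs @ [h]"]
    unfolding h_def[symmetric] by (simp add: vs)
  moreover have "cycle_edges us = sym_diff (walk_sum (x # bs @ [y])) {e}"
    using cycle_edges_eq_walk_sum[OF dist(1) lengths(1)] walk_sum_append[of "x # bs" y "[x]"]
    by (simp add: us_def exy insert_commute)
  moreover have "cycle_edges ws =
      sym_diff (walk_sum (as @ [x])) (sym_diff {e} (walk_sum (y # cs @ [h])))"
    using cycle_edges_eq_walk_sum[OF dist(2) lengths(2)] walk_sum_append[of as x "y # cs @ [h]"]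
    unfolding hws by (simp add: ws_def exy)
  ultimately have "cycle_edges vs = sym_diff (cycle_edges us) (cycle_edges ws)"
    by (simp only:) (rule regroup)
  with cycles lengths show thesis by (intro that) auto
qed

text \<open>Induction on the length: a chord splits every cycle that is not a triangle into two
  shorter ones.\<close>

lemma chordal_cycle_in_triangle_span:
  assumes "simple_graph V E" "chordal V E" "is_cycle V E vs"
  shows "cycle_edges vs \<in> sym_diff_span (triangle_edge_sets V E)"
  using assms(3)
proof (induction "length vs" arbitrary: vs rule: less_induct)
  case less
  show ?case
  proof (cases "length vs = 3")
    case True
    then have "cycle_edges vs \<in> triangle_edge_sets V E"
      using less.prems by (auto simp: triangle_edge_sets_def is_triangle_def)
    then show ?thesis using sym_diff_span_superset by blast
  next
    case False
    then have "4 \<le> length vs" using less.prems by (auto simp: is_cycle_def)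
    then obtain e where "is_chord E vs e" using assms(2) less.prems by (auto simp: chordal_def)
    then obtain us ws where "is_cycle V E us" "is_cycle V E ws"
      "length us < length vs" "length ws < length vs"
      "cycle_edges vs = sym_diff (cycle_edges us) (cycle_edges ws)"
      using cycle_with_chord_splits[OF assms(1) less.prems] by blast
    then show ?thesis using less.hyps sym_diff_span_closed by metis
  qed
qed

lemma chordal_binary_cycle_space:
  assumes "simple_graph V E" "chordal V E"
  shows "binary_cycle_space V E = sym_diff_span (triangle_edge_sets V E)"
  unfolding binary_cycle_space_generated_by_triangles_iff
proof (intro allI impI)
  fix vs assume "is_cycle V E vs"
  then have "cycle_edges vs \<in> sym_diff_span (triangle_edge_sets V E)"
    by (rule chordal_cycle_in_triangle_span[OF assms])
  then show "\<exists>Ts. set Ts \<subseteq> triangle_edge_sets V E \<and> cycle_edges vs = foldr sym_diff Ts {}"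
    unfolding sym_diff_span_def by blast
qed

section \<open>Wheels and neighbourhoods\<close>

text \<open>The rim of an induced wheel is a cycle of length at least 4, and a chord of it would be
  a wheel edge between rim vertices outside the rim.\<close>

lemma chordal_imp_wheel_free:
  assumes "simple_graph V E" "chordal V E"
  shows "wheel_free V E"
  unfolding wheel_free_def
proof
  assume "\<exists>n\<ge>4. \<exists>S\<subseteq>V. graph_isomorphic S (induced_edges E S) (wheel_verts n) (wheel_edges n)"
  then obtain n S f where n: "4 \<le> n" and S: "S \<subseteq> V" and f: "bij_betw f S {..n}"
    and iso: "\<And>u v. u \<in> S \<Longrightarrow> v \<in> S \<Longrightarrow> {u, v} \<in> induced_edges E S \<longleftrightarrow> {f u, f v} \<in> wheel_edges n"
    unfolding graph_isomorphic_def wheel_verts_def by blast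
  define g where "g = inv_into S f"
  have g: "bij_betw g {..n} S" and fg: "\<And>i. i \<le> n \<Longrightarrow> f (g i) = i"
    using f bij_betw_inv_into bij_betw_inv_into_right[OF f] by (auto simp: g_def)
  have gS: "g i \<in> S" if "i \<le> n" for i using g that by (auto simp: bij_betw_def)
  define vs where "vs = map g [0..<n]"
  have len: "length vs = n" by (simp add: vs_def)
  \<comment> \<open>Every spoke contains the hub \<open>n\<close>, so it joins no two rim
    indices.\<close>
  have rim: "{i, j} \<in> wheel_edges n \<longleftrightarrow> {i, j} \<in> cycle_edges [0..<n]" if "i < n" "j < n" for i j
    using that by (auto simp: wheel_edges_def doubleton_eq_iff)
  have dist: "distinct vs"
    using g by (auto simp: vs_def distinct_map bij_betw_def intro: inj_on_subset)
  have edge: "{g i, g j} \<in> E \<longleftrightarrow> {g i, g j} \<in> cycle_edges vs" if "i < n" "j < n" for i j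
  proof -
    have "{g i, g j} \<in> E \<longleftrightarrow> {i, j} \<in> wheel_edges n"
      using iso[of "g i" "g j"] gS[of i] gS[of j] fg that by (auto simp: induced_edges_def)
    also have "\<dots> \<longleftrightarrow> j = Suc i mod n \<or> i = Suc j mod n"
      using rim[OF that] doubleton_in_cycle_edges_iff[of "[0..<n]" i j] that by simp
    also have "\<dots> \<longleftrightarrow> {g i, g j} \<in> cycle_edges vs"
      using doubleton_in_cycle_edges_iff[OF dist, of i j] that by (simp add: len) (simp add: vs_def)
    finally show ?thesis .
  qed
  have "cycle_edges vs \<subseteq> E"
  proof
    fix e assume e: "e \<in> cycle_edges vs"
    then obtain i where "i < n" "e = {vs ! i, vs ! (Suc i mod n)}"
      by (auto simp: cycle_edges_def len)
    then show "e \<in> E" using edge[of i "Suc i mod n"] e n by (auto simp: vs_def)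
  qed
  moreover have "set vs \<subseteq> V" using gS S by (auto simp: vs_def)
  ultimately have "is_cycle V E vs" using dist n by (simp add: is_cycle_def len)
  then obtain e where e: "is_chord E vs e"
    using assms(2) n len unfolding chordal_def by blast
  then obtain u v where "e = {u, v}"
    using bspec[OF assms(1)[unfolded simple_graph_def], of e] by (auto simp: is_chord_def)
  moreover from this e have "u \<in> g ` {..<n}" "v \<in> g ` {..<n}"
    by (auto simp: is_chord_def vs_def atLeast0LessThan)
  ultimately show False using e edge by (auto simp: is_chord_def)
qed

text \<open>A chordless cycle of length at least 4 inside \<open>N\<close> would form an induced
  wheel with hub \<open>v\<close>. \<open>N\<close> may be any set of neighbours, since the
  elimination below uses those in a prescribed vertex set.\<close>

lemma chordal_neighbourhood_if_wheel_free:
  assumes "simple_graph V E" "wheel_free V E" and N: "\<And>x. x \<in> N \<Longrightarrow> {v, x} \<in> E"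
  shows "chordal N (induced_edges E N)"
  unfolding chordal_def
proof (intro allI impI, rule ccontr)
  fix vs assume "is_cycle N (induced_edges E N) vs \<and> 4 \<le> length vs"
    and no_chord: "\<nexists>e. is_chord (induced_edges E N) vs e"
  then have dist: "distinct vs" and vsN: "set vs \<subseteq> N" and edges: "cycle_edges vs \<subseteq> E"
    and len: "4 \<le> length vs"
    by (auto simp: is_cycle_def induced_edges_def)
  define n where "n = length vs"
  define S where "S = insert v (set vs)"
  define g where "g i = (if i = n then v else vs ! i)" for i
  define f where "f = inv_into {..n} g"
  have edge_ne: "a \<noteq> b \<and> a \<in> V \<and> b \<in> V" if "{a, b} \<in> E" for a b
    using assms(1) that unfolding simple_graph_def by (metis doubleton_eq_iff)
  have "v \<notin> set vs" using N vsN edge_ne by blast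
  then have "inj_on g {..n}"
    using dist by (auto simp: inj_on_def g_def n_def nth_eq_iff_index_eq in_set_conv_nth le_less)
  moreover have "g ` {..n} = S"
    by (force simp: g_def S_def n_def in_set_conv_nth image_iff Bex_def le_less)
  ultimately have g: "bij_betw g {..n} S" by (simp add: bij_betw_def)
  have iso: "{g i, g j} \<in> E \<longleftrightarrow> {i, j} \<in> wheel_edges n" if ij: "i \<le> n" "j \<le> n" for i j
  proof -
    have spoke: "{v, vs ! k} \<in> E" if "k < n" for k
      using N[OF subsetD[OF vsN nth_mem]] that by (simp add: n_def)
    \<comment> \<open>The isomorphism condition also ranges over pairs of equal vertices, so the hub
      must carry no loop.\<close>
    have hub: "{n} \<notin> wheel_edges n"
      using cycle_edges_subset[of "{n}" "[0..<n]"] by (auto simp: wheel_edges_def)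
    consider "i = n" "j = n" | "i < n" "j = n" | "i = n" "j < n" | "i < n" "j < n"
      using ij by linarith
    then show ?thesis
    proof cases
      case 1
      then show ?thesis using hub edge_ne[of v v] by (auto simp: g_def)
    next
      case 2
      then show ?thesis using spoke[of i] by (auto simp: g_def wheel_edges_def insert_commute)
    next
      case 3
      then show ?thesis using spoke[of j] by (auto simp: g_def wheel_edges_def insert_commute)
    next
      case 4
      have "{vs ! i, vs ! j} \<in> E \<longleftrightarrow> {vs ! i, vs ! j} \<in> cycle_edges vs"
        using no_chord edges vsN 4 nth_mem[of i vs] nth_mem[of j vs]
        unfolding is_chord_def induced_edges_def n_def by blast
      also have "\<dots> \<longleftrightarrow> {i, j} \<in> cycle_edges [0..<n]"
        using doubleton_in_cycle_edges_iff[OF dist, of i j] 4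
          doubleton_in_cycle_edges_iff[of "[0..<n]" i j] by (simp add: n_def)
      also have "\<dots> \<longleftrightarrow> {i, j} \<in> wheel_edges n"
        using 4 by (auto simp: wheel_edges_def doubleton_eq_iff)
      finally show ?thesis using 4 by (simp add: g_def)
    qed
  qed
  have "bij_betw f S {..n}" unfolding f_def using g by (rule bij_betw_inv_into)
  moreover have "{u, w} \<in> induced_edges E S \<longleftrightarrow> {f u, f w} \<in> wheel_edges n"
    if "u \<in> S" "w \<in> S" for u w
  proof -
    have "f u \<le> n" "f w \<le> n" "g (f u) = u" "g (f w) = w"
      using that g bij_betw_inv_into_right[OF g] \<open>bij_betw f S {..n}\<close>
      by (auto simp: f_def bij_betw_def)
    then show ?thesis using iso[of "f u" "f w"] that by (auto simp: induced_edges_def)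
  qed
  ultimately have "graph_isomorphic S (induced_edges E S) (wheel_verts n) (wheel_edges n)"
    unfolding graph_isomorphic_def wheel_verts_def by blast
  \<comment> \<open>That \<open>v\<close> lies in \<open>V\<close> is read off an edge from
    \<open>v\<close> to a vertex of the nonempty cycle.\<close>
  moreover have "S \<subseteq> V"
  proof -
    have "vs \<noteq> []" using len by auto
    then show ?thesis using N vsN edge_ne unfolding S_def
      by (meson insert_subset list.set_sel(1) subset_eq)
  qed
  ultimately show False using assms(2) len unfolding wheel_free_def n_def by blast
qed

section \<open>Eliminating vertices\<close>

lemma foldr_sym_diff_filter:
  "foldr sym_diff Cs {} =
    sym_diff (foldr sym_diff (filter P Cs) {}) (foldr sym_diff (filter (\<lambda>C. \<not> P C) Cs) {})"
  by (induction Cs) auto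

lemma foldr_sym_diff_subset: "foldr sym_diff Cs {} \<subseteq> \<Union>(set Cs)"
  by (induction Cs) auto

lemma even_degree_foldr_sym_diff:
  assumes "\<And>C. C \<in> set Cs \<Longrightarrow> finite C \<and> \<not> odd_degree x C"
  shows "finite (foldr sym_diff Cs {}) \<and> \<not> odd_degree x (foldr sym_diff Cs {})"
  using assms
proof (induction Cs)
  case (Cons C Cs)
  then show ?case using odd_degree_sym_diff[of C "foldr sym_diff Cs {}" x] by simp
qed (simp add: odd_degree_def)

section \<open>Sums of triangles confined to a vertex set\<close>

lemma triangle_edge_setsE:
  assumes "T \<in> triangle_edge_sets V E"
  obtains a b c where "T = {{a, b}, {b, c}, {c, a}}" "a \<noteq> b" "b \<noteq> c" "c \<noteq> a"
    "a \<in> V" "b \<in> V" "c \<in> V" "{a, b} \<in> E" "{b, c} \<in> E" "{c, a} \<in> E"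
proof -
  obtain vs where T: "T = cycle_edges vs" and vs: "is_cycle V E vs" "length vs = 3"
    using assms by (auto simp: triangle_edge_sets_def is_triangle_def)
  then obtain a b c where abc: "vs = [a, b, c]" by (auto simp: numeral_3_eq_3 length_Suc_conv)
  have "T = {{a, b}, {b, c}, {c, a}}"
    using cycle_edges_eq_walk_edges[of vs] by (simp add: T abc)
  then show thesis using that[of a b c] vs T by (auto simp: is_cycle_def abc)
qed

lemma triangle_edge_setsI:
  assumes "a \<noteq> b" "b \<noteq> c" "c \<noteq> a" "a \<in> V" "b \<in> V" "c \<in> V"
    "{a, b} \<in> E" "{b, c} \<in> E" "{c, a} \<in> E"
  shows "{{a, b}, {b, c}, {c, a}} \<in> triangle_edge_sets V E"
proof -
  have "cycle_edges [a, b, c] = {{a, b}, {b, c}, {c, a}}"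
    using cycle_edges_eq_walk_edges[of "[a, b, c]"] by simp
  moreover from this have "is_triangle V E [a, b, c]"
    using assms by (simp add: is_triangle_def is_cycle_def)
  ultimately show ?thesis unfolding triangle_edge_sets_def by blast
qed

lemma triangle_edge_sets_mono:
  "V \<subseteq> V' \<Longrightarrow> E \<subseteq> E' \<Longrightarrow> triangle_edge_sets V E \<subseteq> triangle_edge_sets V' E'"
  unfolding triangle_edge_sets_def is_triangle_def is_cycle_def by blast

text \<open>The first argument of \<open>triangle_edge_sets\<close> records which vertices the
  triangles may use. The triangles through \<open>v\<close> sum to \<open>F\<close>, the others to
  \<open>R\<close>; only \<open>F\<close> has to be rewritten.\<close>

lemma eliminate_vertex_from_triangle_span:
  assumes "simple_graph V E" "wheel_free V E"
    and D: "D \<in> sym_diff_span (triangle_edge_sets (insert v X) E)" and v: "\<And>e. e \<in> D \<Longrightarrow> v \<notin> e"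
  shows "D \<in> sym_diff_span (triangle_edge_sets X E)"
proof -
  obtain Ts where Ts: "set Ts \<subseteq> triangle_edge_sets (insert v X) E" and DTs: "D = foldr sym_diff Ts {}"
    using D unfolding sym_diff_span_def by blast
  define F where "F = foldr sym_diff (filter (\<lambda>T. v \<in> \<Union>T) Ts) {}"
  define R where "R = foldr sym_diff (filter (\<lambda>T. v \<notin> \<Union>T) Ts) {}"
  have DFR: "D = sym_diff F R"
    unfolding DTs F_def R_def by (rule foldr_sym_diff_filter)
  have "T \<in> triangle_edge_sets X E" if T: "T \<in> set Ts" "v \<notin> \<Union>T" for T
  proof -
    obtain a b c where "T = {{a, b}, {b, c}, {c, a}}" "a \<noteq> b" "b \<noteq> c" "c \<noteq> a"
      "a \<in> insert v X" "b \<in> insert v X" "c \<in> insert v X" "{a, b} \<in> E" "{b, c} \<in> E" "{c, a} \<in> E"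
      by (rule triangle_edge_setsE[OF subsetD[OF Ts T(1)]])
    then show ?thesis using triangle_edge_setsI[of a b c X E] T(2) by auto
  qed
  then have R: "R \<in> sym_diff_span (triangle_edge_sets X E)"
    unfolding R_def sym_diff_span_def
    by (intro CollectI exI[of _ "filter (\<lambda>T. v \<notin> \<Union>T) Ts"]) auto
  have "v \<notin> e" if "e \<in> R" for e
    using that foldr_sym_diff_subset[of "filter (\<lambda>T. v \<notin> \<Union>T) Ts"] unfolding R_def by auto
  \<comment> \<open>\<open>F\<close> is the sum of \<open>D\<close> and \<open>R\<close>, neither of
    which has an edge at \<open>v\<close>.\<close>
  then have vF: "v \<notin> e" if "e \<in> F" for e using that v DFR by blast
  \<comment> \<open>Only neighbours inside \<open>X\<close> are taken, so that the new triangles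
    introduce no vertex outside \<open>X\<close>.\<close>
  define N where "N = {x \<in> X. {v, x} \<in> E}"
  \<comment> \<open>An edge of \<open>F\<close> lies in a triangle through \<open>v\<close> but
    misses \<open>v\<close>, so it is the side opposite \<open>v\<close> and both its ends are
    neighbours of \<open>v\<close>.\<close>
  have F_edges: "F \<subseteq> induced_edges E N"
  proof
    fix e assume e: "e \<in> F"
    then obtain T where T: "T \<in> set Ts" "v \<in> \<Union>T" "e \<in> T"
      using foldr_sym_diff_subset[of "filter (\<lambda>T. v \<in> \<Union>T) Ts"] unfolding F_def by auto
    obtain a b c where "T = {{a, b}, {b, c}, {c, a}}" "a \<noteq> b" "b \<noteq> c" "c \<noteq> a"
      "a \<in> insert v X" "b \<in> insert v X" "c \<in> insert v X" "{a, b} \<in> E" "{b, c} \<in> E" "{c, a} \<in> E"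
      by (rule triangle_edge_setsE[OF subsetD[OF Ts T(1)]])
    then show "e \<in> induced_edges E N"
      using T(2,3) vF[OF e] by (auto simp: induced_edges_def N_def insert_commute)
  qed
  have "finite T \<and> \<not> odd_degree x T" if T: "T \<in> set Ts" for T x
  proof -
    obtain vs where "T = cycle_edges vs" "distinct vs" "3 \<le> length vs"
      using subsetD[OF Ts T] unfolding triangle_edge_sets_def is_triangle_def is_cycle_def by blast
    then show ?thesis by (simp add: finite_cycle_edges even_degree_cycle_edges)
  qed
  then have F_even: "finite F" "\<not> odd_degree x F" for x
    unfolding F_def using even_degree_foldr_sym_diff[of "filter (\<lambda>T. v \<in> \<Union>T) Ts"] by auto
  have "simple_graph N (induced_edges E N)"
    using assms(1) unfolding simple_graph_def induced_edges_def by fastforce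
  moreover have "chordal N (induced_edges E N)"
    by (rule chordal_neighbourhood_if_wheel_free[OF assms(1,2), of N v]) (simp add: N_def)
  \<comment> \<open>Being finite and even, \<open>F\<close> is a sum of cycles in the graph induced
    on \<open>N\<close>; chordality of that graph turns these into triangles.\<close>
  ultimately have "F \<in> sym_diff_span (triangle_edge_sets N (induced_edges E N))"
    using even_edge_set_in_binary_cycle_space[OF _ F_edges F_even, of N]
      chordal_binary_cycle_space[of N "induced_edges E N"]
    by simp
  moreover have "triangle_edge_sets N (induced_edges E N) \<subseteq> triangle_edge_sets X E"
    by (rule triangle_edge_sets_mono) (auto simp: N_def induced_edges_def)
  ultimately have "F \<in> sym_diff_span (triangle_edge_sets X E)"
    using sym_diff_span_mono by blast
  then show ?thesis unfolding DFR using R by (rule sym_diff_span_closed)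
qed

text \<open>Induction on \<open>Y\<close>: a vertex outside \<open>X\<close> is on no edge of
  \<open>D\<close>, so it can be eliminated.\<close>

lemma eliminate_vertices_from_triangle_span:
  assumes "simple_graph V E" "wheel_free V E" "finite Y"
    "D \<in> sym_diff_span (triangle_edge_sets (Y \<union> X) E)" "\<And>e. e \<in> D \<Longrightarrow> e \<subseteq> X"
  shows "D \<in> sym_diff_span (triangle_edge_sets X E)"
  using assms(3,4)
proof (induction Y)
  case (insert v Y)
  show ?case
  proof (cases "v \<in> X")
    case True
    then show ?thesis using insert by (simp add: insert_absorb)
  next
    case False
    then have "v \<notin> e" if "e \<in> D" for e using assms(5) that by blast
    then show ?thesis
      using insert eliminate_vertex_from_triangle_span[OF assms(1,2), of D v "Y \<union> X"] by simp
  qed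
qed simp

text \<open>A finite sum of triangles meets finitely many vertices even if the graph is infinite, so
  the elimination terminates.\<close>

lemma triangle_span_finite_support:
  assumes "D \<in> sym_diff_span (triangle_edge_sets V E)"
  obtains Y where "finite Y" "D \<in> sym_diff_span (triangle_edge_sets Y E)"
proof -
  obtain Ts where Ts: "set Ts \<subseteq> triangle_edge_sets V E" "D = foldr sym_diff Ts {}"
    using assms unfolding sym_diff_span_def by blast
  define Y where "Y = (\<Union>T\<in>set Ts. \<Union>T)"
  have "finite (\<Union>T) \<and> T \<in> triangle_edge_sets Y E" if T: "T \<in> set Ts" for T
  proof -
    obtain a b c where "T = {{a, b}, {b, c}, {c, a}}" "a \<noteq> b" "b \<noteq> c" "c \<noteq> a"
      "{a, b} \<in> E" "{b, c} \<in> E" "{c, a} \<in> E"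
      by (rule triangle_edge_setsE[OF subsetD[OF Ts(1) T]])
    moreover from this have "{a, b, c} \<subseteq> Y" using T unfolding Y_def by blast
    ultimately show ?thesis using triangle_edge_setsI[of a b c Y E] by auto
  qed
  then have "finite Y" "set Ts \<subseteq> triangle_edge_sets Y E" by (auto simp: Y_def)
  then show thesis using that[of Y] Ts(2) unfolding sym_diff_span_def by blast
qed

text \<open>Going round a triangle would change the index by three steps of plus or minus 1. Their
  total is odd and at most 3 in absolute value, so it cannot vanish modulo a length of at least
  4.\<close>

lemma no_triangle_in_cycle_edges:
  assumes "distinct vs" "4 \<le> length vs"
  shows "triangle_edge_sets (set vs) (cycle_edges vs) = {}"
proof (rule ccontr)
  assume "triangle_edge_sets (set vs) (cycle_edges vs) \<noteq> {}"
  then obtain T where "T \<in> triangle_edge_sets (set vs) (cycle_edges vs)" by blast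
  then obtain a b c where abc: "a \<noteq> b" "b \<noteq> c" "c \<noteq> a" "a \<in> set vs" "b \<in> set vs" "c \<in> set vs"
    "{a, b} \<in> cycle_edges vs" "{b, c} \<in> cycle_edges vs" "{c, a} \<in> cycle_edges vs"
    by (rule triangle_edge_setsE)
  then obtain i j k where ijk: "i < length vs" "j < length vs" "k < length vs"
    "a = vs ! i" "b = vs ! j" "c = vs ! k"
    by (metis in_set_conv_nth)
  have "j = Suc i mod length vs \<or> i = Suc j mod length vs"
    "k = Suc j mod length vs \<or> j = Suc k mod length vs"
    "i = Suc k mod length vs \<or> k = Suc i mod length vs"
    using abc(7-9) ijk doubleton_in_cycle_edges_iff[OF assms(1)] by auto
  moreover have "i \<noteq> j" "j \<noteq> k" "k \<noteq> i" using abc(1-3) ijk by auto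
  ultimately show False using ijk(1-3) assms(2) by (auto simp: mod_Suc split: if_splits)
qed

lemma chordal_if_wheel_free_triangle_generated:
  assumes "simple_graph V E" "wheel_free V E"
    and gen: "binary_cycle_space V E = sym_diff_span (triangle_edge_sets V E)"
  shows "chordal V E"
  unfolding chordal_def
proof (intro allI impI, rule ccontr)
  fix vs assume vs: "is_cycle V E vs \<and> 4 \<le> length vs" and no_chord: "\<nexists>e. is_chord E vs e"
  have "cycle_edges vs \<in> binary_cycle_space V E"
    using vs cycle_edges_in_binary_cycle_space by blast
  then obtain Y where Y: "finite Y" "cycle_edges vs \<in> sym_diff_span (triangle_edge_sets Y E)"
    unfolding gen by (rule triangle_span_finite_support)
  have "triangle_edge_sets Y E \<subseteq> triangle_edge_sets (Y \<union> set vs) E"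
    by (rule triangle_edge_sets_mono) auto
  then have "cycle_edges vs \<in> sym_diff_span (triangle_edge_sets (Y \<union> set vs) E)"
    using Y(2) sym_diff_span_mono by blast
  then have "cycle_edges vs \<in> sym_diff_span (triangle_edge_sets (set vs) E)"
    using eliminate_vertices_from_triangle_span[OF assms(1,2) Y(1)] cycle_edges_subset by blast
  \<comment> \<open>Without a chord, every edge between vertices of \<open>vs\<close> is an edge of
    the cycle.\<close>
  moreover have "triangle_edge_sets (set vs) E \<subseteq> triangle_edge_sets (set vs) (cycle_edges vs)"
  proof
    fix T assume "T \<in> triangle_edge_sets (set vs) E"
    then obtain a b c where abc: "T = {{a, b}, {b, c}, {c, a}}" "a \<noteq> b" "b \<noteq> c" "c \<noteq> a"
      "a \<in> set vs" "b \<in> set vs" "c \<in> set vs" "{a, b} \<in> E" "{b, c} \<in> E" "{c, a} \<in> E"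
      by (rule triangle_edge_setsE)
    then have "{a, b} \<in> cycle_edges vs" "{b, c} \<in> cycle_edges vs" "{c, a} \<in> cycle_edges vs"
      using no_chord unfolding is_chord_def by blast+
    with abc show "T \<in> triangle_edge_sets (set vs) (cycle_edges vs)"
      using triangle_edge_setsI[of a b c] by simp
  qed
  then have "triangle_edge_sets (set vs) E = {}"
    using no_triangle_in_cycle_edges[of vs] vs unfolding is_cycle_def by blast
  \<comment> \<open>With no triangles left, the only sum is the empty one.\<close>
  ultimately have "cycle_edges vs = {}" by (auto simp: sym_diff_span_def)
  then show False using vs cycle_edges_nonempty[of vs] by fastforce
qed

theorem theorem3:
  fixes V :: "'a set" and E :: "'a set set"
  assumes "simple_graph V E"
  shows "chordal V E \<longleftrightarrow>
    wheel_free V E \<and> binary_cycle_space V E = sym_diff_span (triangle_edge_sets V E)"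
  using chordal_imp_wheel_free[OF assms] chordal_binary_cycle_space[OF assms]
    chordal_if_wheel_free_triangle_generated[OF assms]
  by blast

end
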